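(* Let $l=1$ and consider either $T=[-\pi,\pi]$ with Lebesgue measure and $A(n)$ the set of trigonometric polynomials of degree $\le n$, or $T=\mathbb R$ with Lebesgue measure and $A(n)$ the set of entire functions of exponential type $\le n$; in both cases $\sigma(n)=n$, $n\ge 3$. Let $\Phi_1,\Phi_2$ be two Orlicz functions such that for some $m\in\{1,2,3,\ldots\}$ and some constant $C_m\in(0,\infty)$, for all $v\ge1$, $$\int_1^\infty\Phi_i\left(v/y^{2m}\right)dy\le\Phi_i(C_mv),\qquad i=1,2.$$ Then there exist positive finite constants $K_1,K_2,K_3$, depending only on $\Phi_1,\Phi_2,T$, such that $$\liminf_{n\to\infty}W_n(L(\Phi_1),L(\Phi_2),K_1,K_2)\ge K_3 .$$
   Context: An Orlicz function is a function $\Phi:\mathbb R\to[0,\infty)$ that is even, twice continuously differentiable, convex, with $\lim_{u\to0}\Phi(u)/u=0$ and $\lim_{u\to\infty}\Phi(u)/u=\infty$. The Orlicz space $L(\Phi)$ over $T$ has the norm $\|f\|L(\Phi)=\inf_{v>0}\frac{1}{v}\left[1+\int_T\Phi(vf(x))\,dx\right]$ (equivalently, up to norm equivalence, $\inf\{v>0:\int_T\Phi(|f(x)|/v)\,dx\le1\}$). Entire functions of exponential type $\le n$ on $\mathbb R$: functions $t_n(x)=\int_{-n}^{n}e^{ix\xi}g(\xi)\,d\xi$ with $g\in L_2(\mathbb R)$. Fundamental function of a rearrangement invariant space $(X,\|\cdot\|X)$ over $T$: $\phi(X,\delta)=\sup_{A:\,m(A)\le\delta}\|I(A)\|X$, where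 $m(A)$ is the Lebesgue measure of $A$ and $I(A)$ is its indicator. Nikol'skii two-space functional: $$W_n(X,Y,K_1,K_2)=\sup_{t_n\in A(n),\,t_n\ne0}\left[\frac{\|t_n\|X}{\phi(X,K_1/\sigma(n))}\Big/\frac{\|t_n\|Y}{\phi(Y,K_2/\sigma(n))}\right],$$ the supremum being over those $t_n$ for which the ratio is meaningful. *)

theory Defs
  imports "HOL-Analysis.Analysis"
begin

definition orlicz_function :: "(real \<Rightarrow> real) \<Rightarrow> bool" where
  "orlicz_function \<Phi> \<longleftrightarrow>
     (\<forall>u. 0 \<le> \<Phi> u) \<and>
     (\<forall>u. \<Phi> (- u) = \<Phi> u) \<and>
     (\<exists>\<Phi>' \<Phi>''. (\<forall>u. (\<Phi> has_real_derivative \<Phi>' u) (at u)) \<and>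
              (\<forall>u. (\<Phi>' has_real_derivative \<Phi>'' u) (at u)) \<and>
              continuous_on UNIV \<Phi>'') \<and>
     convex_on UNIV \<Phi> \<and>
     ((\<lambda>u. \<Phi> u / u) \<longlongrightarrow> 0) (at 0) \<and>
     filterlim (\<lambda>u. \<Phi> u / u) at_top at_top"

text \<open>
  A function space is represented by its extended norm: a measurable function has norm
  \<open>\<infinity>\<close> exactly when it lies outside the space. Functions are complex valued; since \<open>\<Phi>\<close> is even,
  \<open>\<Phi> (v * cmod (f x))\<close> is \<open>\<Phi> (v f(x))\<close> when \<open>f\<close> is real valued.
\<close>

definition orlicz_norm :: "'a measure \<Rightarrow> (real \<Rightarrow> real) \<Rightarrow> ('a \<Rightarrow> complex) \<Rightarrow> ennreal" where
  "orlicz_norm M \<Phi> f =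
     (INF v\<in>{0<..}. (1 + (\<integral>\<^sup>+x. ennreal (\<Phi> (v * cmod (f x))) \<partial>M)) / ennreal v)"

definition fundamental_function ::
    "'a measure \<Rightarrow> (('a \<Rightarrow> complex) \<Rightarrow> ennreal) \<Rightarrow> real \<Rightarrow> ennreal" where
  "fundamental_function M X \<delta> =
     (SUP A\<in>{A \<in> sets M. emeasure M A \<le> ennreal \<delta>}. X (indicator A))"

definition trig_polys :: "nat \<Rightarrow> (real \<Rightarrow> complex) set" where
  "trig_polys n =
     {t. \<exists>c :: int \<Rightarrow> complex.
           t = (\<lambda>x. \<Sum>k\<in>{- int n..int n}. c k * exp (\<i> * of_int k * of_real x))}"

definition exp_type_functions :: "nat \<Rightarrow> (real \<Rightarrow> complex) set" where
  "exp_type_functions n =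
     {t. \<exists>g :: real \<Rightarrow> complex.
           g \<in> borel_measurable lebesgue \<and>
           integrable lebesgue (\<lambda>\<xi>. (cmod (g \<xi>))\<^sup>2) \<and>
           t = (\<lambda>x. LINT \<xi>:{- real n..real n}|lebesgue.
                      exp (\<i> * of_real x * of_real \<xi>) * g \<xi>)}"

text \<open>
  The ratio is taken to be meaningful when \<open>t\<close> belongs to both spaces and its \<open>Y\<close>-norm, which
  is divided by, does not vanish. The two fundamental functions are positive and finite at positive
  arguments for Orlicz spaces over intervals.
\<close>

definition nikolskii_W ::
    "'a measure \<Rightarrow> (nat \<Rightarrow> ('a \<Rightarrow> complex) set) \<Rightarrow> (nat \<Rightarrow> real) \<Rightarrow>
     (('a \<Rightarrow> complex) \<Rightarrow> ennreal) \<Rightarrow> (('a \<Rightarrow> complex) \<Rightarrow> ennreal) \<Rightarrow>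
     real \<Rightarrow> real \<Rightarrow> nat \<Rightarrow> ennreal" where
  "nikolskii_W M A \<sigma> X Y K1 K2 n =
     (SUP t\<in>{t \<in> A n. t \<noteq> (\<lambda>x. 0) \<and> X t < \<infinity> \<and> 0 < Y t \<and> Y t < \<infinity>}.
        (X t / fundamental_function M X (K1 / \<sigma> n)) /
        (Y t / fundamental_function M Y (K2 / \<sigma> n)))"

end

theory Submission
  imports Defs
begin

text \<open>
  The supremum defining \<open>W\<^sub>n\<close> is tested on one function \<open>t\<^sub>n\<close> concentrated at scale \<open>1/n\<close>: it satisfies
  \<open>|t\<^sub>n| \<ge> c\<close> for \<open>n |x| \<le> 1\<close> and \<open>|t\<^sub>n(x)| \<le> min 1 ((C / (n |x|))\<^sup>2\<^sup>m)\<close> on \<open>T\<close>. The fundamental function of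
  \<open>L(\<Phi>)\<close> is the gauge \<open>inf\<^sub>v (1 + \<delta> \<Phi>(v)) / v\<close>. The first property bounds every Orlicz norm of \<open>t\<^sub>n\<close>
  below by \<open>c\<close> times the gauge at \<open>2/n\<close>; the second, with the integral condition on \<open>\<Phi>\<close> controlling the
  tail, bounds it above by a constant times the gauge at \<open>4C/n\<close>.
\<close>

subsection \<open>Orlicz norms and fundamental functions\<close>

lemma orlicz_function_nonneg: "orlicz_function \<Phi> \<Longrightarrow> 0 \<le> \<Phi> u"
  and orlicz_function_convex: "orlicz_function \<Phi> \<Longrightarrow> convex_on UNIV \<Phi>"
  and orlicz_function_superlinear:
    "orlicz_function \<Phi> \<Longrightarrow> filterlim (\<lambda>u. \<Phi> u / u) at_top at_top"
  by (auto simp: orlicz_function_def)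

lemma orlicz_function_continuous: "orlicz_function \<Phi> \<Longrightarrow> continuous_on UNIV \<Phi>"
  unfolding orlicz_function_def by (metis DERIV_continuous_on)

lemma orlicz_function_measurable [measurable]:
  "orlicz_function \<Phi> \<Longrightarrow> \<Phi> \<in> borel_measurable borel"
  using borel_measurable_continuous_onI orlicz_function_continuous by blast

text \<open>Since \<open>\<Phi> u = u * (\<Phi> u / u)\<close> away from 0, the limit hypothesis at
  0 sends this product to 0, and continuity turns the limit into a value.\<close>

lemma orlicz_function_0:
  assumes "orlicz_function \<Phi>"
  shows "\<Phi> 0 = 0"
proof -
  have "((\<lambda>u. \<Phi> u / u) \<longlongrightarrow> 0) (at 0)"
    using assms by (simp add: orlicz_function_def)
  then have "((\<lambda>u. u * (\<Phi> u / u)) \<longlongrightarrow> 0 * 0) (at 0)"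
    by (intro tendsto_intros)
  then have "((\<lambda>u. u * (\<Phi> u / u)) \<longlongrightarrow> 0) (at 0)"
    by simp
  then have "(\<Phi> \<longlongrightarrow> 0) (at 0)"
    by (rule Lim_transform_eventually) (auto simp: eventually_at_filter)
  moreover have "(\<Phi> \<longlongrightarrow> \<Phi> 0) (at 0)"
    using orlicz_function_continuous[OF assms] by (simp add: continuous_on_def)
  ultimately show ?thesis
    using LIM_unique by blast
qed

text \<open>By convexity \<open>\<Phi>\<close> lies below its chord from 0 to \<open>b\<close>, and
  that chord rises from \<open>\<Phi> 0 = 0\<close> to the nonnegative value
  \<open>\<Phi> b\<close>.\<close>

lemma orlicz_function_mono:
  assumes "orlicz_function \<Phi>" "0 \<le> a" "a \<le> b"
  shows "\<Phi> a \<le> \<Phi> b"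
proof (cases "b = 0")
  case False
  define t where "t = a / b"
  have t: "0 \<le> t" "t \<le> 1" "a = t * b"
    using assms False by (auto simp: t_def)
  have "\<Phi> ((1 - t) *\<^sub>R 0 + t *\<^sub>R b) \<le> (1 - t) * \<Phi> 0 + t * \<Phi> b"
    using t by (intro convex_onD[OF orlicz_function_convex[OF assms(1)]]) auto
  also have "\<dots> \<le> \<Phi> b"
    using t orlicz_function_0[OF assms(1)] orlicz_function_nonneg[OF assms(1)]
    by (simp add: mult_left_le_one_le)
  finally show ?thesis
    using t by simp
qed (use assms in simp)

text \<open>For \<delta> \<ge> 0 this is the Orlicz norm of the indicator of any set of measure
  \<delta>. Being free of the measure space, it mediates between norms of test functions and
  fundamental functions for both choices of \<open>T\<close>.\<close>

definition orlicz_gauge :: "(real \<Rightarrow> real) \<Rightarrow> real \<Rightarrow> ennreal" where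
  "orlicz_gauge \<Phi> \<delta> = (INF v\<in>{0<..}. ennreal ((1 + \<delta> * \<Phi> v) / v))"

lemma orlicz_gauge_le: "0 < v \<Longrightarrow> orlicz_gauge \<Phi> \<delta> \<le> ennreal ((1 + \<delta> * \<Phi> v) / v)"
  unfolding orlicz_gauge_def by (intro INF_lower) simp

lemma orlicz_gauge_less_top: "orlicz_gauge \<Phi> \<delta> < \<infinity>"
  using orlicz_gauge_le[of 1 \<Phi> \<delta>] by (simp add: le_less_trans)

text \<open>The competing values cannot tend to 0: superlinear growth keeps them above \<delta> for
  large \<open>v\<close>, and the summand \<open>1 / v\<close> keeps them away from 0 for the
  remaining \<open>v\<close>.\<close>

lemma orlicz_gauge_pos:
  assumes "orlicz_function \<Phi>" "0 < \<delta>"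
  shows "0 < orlicz_gauge \<Phi> \<delta>"
proof -
  obtain u where u: "\<And>v. u \<le> v \<Longrightarrow> 1 \<le> \<Phi> v / v"
    using orlicz_function_superlinear[OF assms(1)]
    unfolding filterlim_at_top eventually_at_top_linorder by meson
  \<comment> \<open>The threshold \<open>u\<close> may be negative or zero; \<open>w\<close> is a
    positive replacement.\<close>
  define w where "w = max u 1"
  have "ennreal (min \<delta> (1 / w)) \<le> ennreal ((1 + \<delta> * \<Phi> v) / v)" if "0 < v" for v
  proof (rule ennreal_leI, cases "u \<le> v")
    case True
    have "\<delta> * v \<le> \<delta> * \<Phi> v"
      using u[OF True] that assms(2) by (simp add: field_simps)
    then have "\<delta> \<le> (1 + \<delta> * \<Phi> v) / v"
      using that by (simp add: field_simps)
    then show "min \<delta> (1 / w) \<le> (1 + \<delta> * \<Phi> v) / v"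
      by linarith
  next
    case False
    have "1 / w \<le> 1 / v"
      using that False by (intro divide_left_mono) (auto simp: w_def)
    also have "\<dots> \<le> (1 + \<delta> * \<Phi> v) / v"
      using that assms orlicz_function_nonneg[OF assms(1), of v] by (simp add: divide_right_mono)
    finally show "min \<delta> (1 / w) \<le> (1 + \<delta> * \<Phi> v) / v"
      by linarith
  qed
  then have "ennreal (min \<delta> (1 / w)) \<le> orlicz_gauge \<Phi> \<delta>"
    unfolding orlicz_gauge_def by (intro INF_greatest) auto
  moreover have "0 < ennreal (min \<delta> (1 / w))"
    using assms(2) by (simp add: w_def)
  ultimately show ?thesis
    by (rule less_le_trans[rotated])
qed

section \<open>Orlicz norms and fundamental functions compared with the gauge\<close>

lemma orlicz_norm_leI:
  assumes "0 < v" "0 \<le> a" "(\<integral>\<^sup>+x. ennreal (\<Phi> (v * cmod (f x))) \<partial>M) \<le> ennreal a"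
  shows "orlicz_norm M \<Phi> f \<le> ennreal ((1 + a) / v)"
proof -
  have "orlicz_norm M \<Phi> f \<le> (1 + (\<integral>\<^sup>+x. ennreal (\<Phi> (v * cmod (f x))) \<partial>M)) / ennreal v"
    unfolding orlicz_norm_def using assms(1) by (intro INF_lower) simp
  also have "\<dots> \<le> (ennreal 1 + ennreal a) / ennreal v"
    using assms(3) by (intro divide_right_mono_ennreal add_mono) auto
  also have "\<dots> = ennreal ((1 + a) / v)"
    using assms by (subst ennreal_plus[symmetric]) (simp_all add: divide_ennreal del: ennreal_plus)
  finally show ?thesis .
qed

text \<open>Restricting the modular to \<open>S\<close> and using monotonicity leaves at least
  \<open>\<delta> * \<Phi> (v * c)\<close>. The rescaling of \<open>v\<close> by \<open>c\<close> is
  what produces the factor \<open>c\<close>.\<close>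

lemma orlicz_norm_ge_gauge:
  assumes \<Phi>: "orlicz_function \<Phi>"
    and S: "S \<in> sets M" "emeasure M S = ennreal \<delta>" "0 \<le> \<delta>"
    and c: "0 < c" "\<And>x. x \<in> S \<Longrightarrow> c \<le> cmod (f x)"
  shows "ennreal c * orlicz_gauge \<Phi> \<delta> \<le> orlicz_norm M \<Phi> f"
  unfolding orlicz_norm_def
proof (rule INF_greatest)
  fix v :: real
  assume "v \<in> {0<..}"
  then have v: "0 < v" by simp
  have "ennreal (\<Phi> (v * c)) * emeasure M S = (\<integral>\<^sup>+x. ennreal (\<Phi> (v * c)) * indicator S x \<partial>M)"
    using S(1) by (simp add: nn_integral_cmult_indicator)
  also have "\<dots> \<le> (\<integral>\<^sup>+x. ennreal (\<Phi> (v * cmod (f x))) \<partial>M)"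
    using v c by (intro nn_integral_mono)
      (auto simp: indicator_def intro!: ennreal_leI orlicz_function_mono[OF \<Phi>])
  finally have *: "ennreal (\<delta> * \<Phi> (v * c)) \<le> (\<integral>\<^sup>+x. ennreal (\<Phi> (v * cmod (f x))) \<partial>M)"
    using S orlicz_function_nonneg[OF \<Phi>] by (simp add: ennreal_mult' mult.commute)
  \<comment> \<open>The gauge is tested at \<open>v * c\<close>; multiplying by \<open>c\<close>
    then restores the denominator \<open>v\<close>.\<close>
  have "ennreal c * orlicz_gauge \<Phi> \<delta> \<le> ennreal c * ennreal ((1 + \<delta> * \<Phi> (v * c)) / (v * c))"
    using v c by (intro mult_left_mono orlicz_gauge_le) auto
  also have "\<dots> = ennreal ((1 + \<delta> * \<Phi> (v * c)) / v)"
    using v c by (simp flip: ennreal_mult')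
  also have "\<dots> = (1 + ennreal (\<delta> * \<Phi> (v * c))) / ennreal v"
    using v S orlicz_function_nonneg[OF \<Phi>]
    by (simp add: divide_ennreal[symmetric])
  also have "\<dots> \<le> (1 + (\<integral>\<^sup>+x. ennreal (\<Phi> (v * cmod (f x))) \<partial>M)) / ennreal v"
    using * by (intro divide_right_mono_ennreal add_mono) auto
  finally show "ennreal c * orlicz_gauge \<Phi> \<delta>
    \<le> (1 + (\<integral>\<^sup>+x. ennreal (\<Phi> (v * cmod (f x))) \<partial>M)) / ennreal v" .
qed

text \<open>Because \<open>\<Phi> 0 = 0\<close>, the modular of \<open>v\<close> times an indicator
  is \<open>\<Phi> v\<close> times the measure of the set, hence at most
  \<open>\<delta> * \<Phi> v\<close>.\<close>

lemma fundamental_function_le_gauge: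
  assumes \<Phi>: "orlicz_function \<Phi>" and "0 \<le> \<delta>"
  shows "fundamental_function M (orlicz_norm M \<Phi>) \<delta> \<le> orlicz_gauge \<Phi> \<delta>"
  unfolding fundamental_function_def
proof (rule SUP_least)
  fix A
  assume "A \<in> {A \<in> sets M. emeasure M A \<le> ennreal \<delta>}"
  then have A: "A \<in> sets M" "emeasure M A \<le> ennreal \<delta>" by auto
  show "orlicz_norm M \<Phi> (indicator A) \<le> orlicz_gauge \<Phi> \<delta>"
    unfolding orlicz_gauge_def
  proof (rule INF_greatest)
    fix v :: real
    assume "v \<in> {0<..}"
    then have v: "0 < v" by simp
    have "(\<integral>\<^sup>+x. ennreal (\<Phi> (v * cmod (indicator A x))) \<partial>M)
        = (\<integral>\<^sup>+x. ennreal (\<Phi> v) * indicator A x \<partial>M)"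
      by (intro nn_integral_cong) (auto simp: indicator_def orlicz_function_0[OF \<Phi>])
    also have "\<dots> = ennreal (\<Phi> v) * emeasure M A"
      using A(1) by (simp add: nn_integral_cmult_indicator)
    also have "\<dots> \<le> ennreal (\<Phi> v) * ennreal \<delta>"
      using A(2) by (rule mult_left_mono) simp
    also have "\<dots> = ennreal (\<delta> * \<Phi> v)"
      using assms orlicz_function_nonneg[OF \<Phi>] by (simp add: ennreal_mult' mult.commute)
    finally show "orlicz_norm M \<Phi> (indicator A) \<le> ennreal ((1 + \<delta> * \<Phi> v) / v)"
      using v assms orlicz_function_nonneg[OF \<Phi>] by (intro orlicz_norm_leI) auto
  qed
qed

text \<open>The indicator of \<open>S\<close> itself competes in the supremum. A set of measure
  exactly \<delta> has to exist, which on a bounded \<open>T\<close> limits \<delta> and later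
  forces \<open>n\<close> to be large.\<close>

lemma fundamental_function_ge_gauge:
  assumes "orlicz_function \<Phi>" "S \<in> sets M" "emeasure M S = ennreal \<delta>" "0 \<le> \<delta>"
  shows "orlicz_gauge \<Phi> \<delta> \<le> fundamental_function M (orlicz_norm M \<Phi>) \<delta>"
proof -
  have "ennreal 1 * orlicz_gauge \<Phi> \<delta> \<le> orlicz_norm M \<Phi> (indicator S)"
    using assms by (intro orlicz_norm_ge_gauge) auto
  also have "\<dots> \<le> fundamental_function M (orlicz_norm M \<Phi>) \<delta>"
    unfolding fundamental_function_def using assms by (intro SUP_upper) auto
  finally show ?thesis by simp
qed

text \<open>A modular bound is only available for \<open>v \<ge> 1\<close>. Dropping \<open>w < C\<close> from the infimum defining the
  gauge costs a bounded factor, because \<open>(1 + \<delta> \<Phi>(w)) / w \<ge> 1 / C\<close> there while the value at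
  \<open>w = C\<close> is at most \<open>(1 + \<Delta> \<Phi>(C)) / C\<close>.\<close>

lemma orlicz_norm_le_gauge:
  assumes \<Phi>: "orlicz_function \<Phi>" and C: "1 \<le> C" and \<delta>: "0 \<le> \<delta>" "\<delta> \<le> \<Delta>"
    and f: "\<And>v. 1 \<le> v \<Longrightarrow> (\<integral>\<^sup>+x. ennreal (\<Phi> (v * cmod (f x))) \<partial>M) \<le> ennreal (\<delta> * \<Phi> (C * v))"
  shows "orlicz_norm M \<Phi> f \<le> ennreal (C * (1 + \<Delta> * \<Phi> C)) * orlicz_gauge \<Phi> \<delta>"
proof -
  note nn = orlicz_function_nonneg[OF \<Phi>]
  define K where "K = C * (1 + \<Delta> * \<Phi> C)"
  have KC: "C \<le> K"
    unfolding K_def using C \<delta> nn[of C] mult_left_mono[of 1 "1 + \<Delta> * \<Phi> C" C] by simp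
  have le: "orlicz_norm M \<Phi> f \<le> ennreal (C * ((1 + \<delta> * \<Phi> w) / w))" if "C \<le> w" for w
  proof -
    \<comment> \<open>The norm is tested at \<open>w / C\<close>, which is at least 1, so the
      modular bound applies and returns \<open>\<Phi> w\<close>.\<close>
    have "orlicz_norm M \<Phi> f \<le> ennreal ((1 + \<delta> * \<Phi> (C * (w / C))) / (w / C))"
      using that C \<delta> nn by (intro orlicz_norm_leI f) auto
    then show ?thesis
      using C by (simp add: field_simps)
  qed
  have "orlicz_norm M \<Phi> f / ennreal K \<le> ennreal ((1 + \<delta> * \<Phi> w) / w)" if w: "0 < w" for w
  proof -
    have "orlicz_norm M \<Phi> f \<le> ennreal (K * ((1 + \<delta> * \<Phi> w) / w))"
    proof (cases "C \<le> w")
      case True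
      have "C * ((1 + \<delta> * \<Phi> w) / w) \<le> K * ((1 + \<delta> * \<Phi> w) / w)"
        using KC w \<delta> nn[of w] by (intro mult_right_mono) auto
      then show ?thesis
        using le[OF True] ennreal_leI order_trans by blast
    next
      case False
      have "C * ((1 + \<delta> * \<Phi> C) / C) \<le> 1 + \<Delta> * \<Phi> C"
        using C \<delta> nn[of C] by (simp add: mult_right_mono)
      also have "\<dots> = K * (1 / C)"
        using C by (simp add: K_def)
      also have "\<dots> \<le> K * ((1 + \<delta> * \<Phi> w) / w)"
      proof (rule mult_left_mono)
        have "1 / C \<le> 1 / w"
          using False w by (intro divide_left_mono) auto
        also have "\<dots> \<le> (1 + \<delta> * \<Phi> w) / w"
          using w \<delta> nn[of w] by (simp add: divide_right_mono)
        finally show "1 / C \<le> (1 + \<delta> * \<Phi> w) / w" .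
      qed (use KC C in simp)
      finally show ?thesis
        using le[of C] ennreal_leI order_trans by blast
    qed
    then have "orlicz_norm M \<Phi> f / ennreal K \<le> ennreal (K * ((1 + \<delta> * \<Phi> w) / w)) / ennreal K"
      by (rule divide_right_mono_ennreal)
    also have "\<dots> = ennreal ((1 + \<delta> * \<Phi> w) / w)"
      using KC C w \<delta> nn[of w] by (simp add: divide_ennreal)
    finally show ?thesis .
  qed
  then have *: "orlicz_norm M \<Phi> f / ennreal K \<le> orlicz_gauge \<Phi> \<delta>"
    unfolding orlicz_gauge_def by (intro INF_greatest) auto
  have "orlicz_norm M \<Phi> f = ennreal K * (orlicz_norm M \<Phi> f / ennreal K)"
    using KC C by (simp add: ennreal_times_divide mult_divide_eq_ennreal mult.commute[of "ennreal K"])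
  also have "\<dots> \<le> ennreal K * orlicz_gauge \<Phi> \<delta>"
    using * by (rule mult_left_mono) simp
  finally show ?thesis
    by (simp add: K_def)
qed

subsection \<open>Concentrated trigonometric polynomials\<close>

lemma exp_in_trig_polys:
  assumes "\<bar>k\<bar> \<le> int n"
  shows "(\<lambda>x. exp (\<i> * of_int k * of_real x)) \<in> trig_polys n"
  unfolding trig_polys_def using assms
  by (intro CollectI exI[of _ "\<lambda>j. if j = k then 1 else 0"])
     (auto simp: if_distrib[of "\<lambda>c. c * _"] sum.delta fun_eq_iff cong: if_cong)

lemma cmult_in_trig_polys:
  assumes "t \<in> trig_polys n"
  shows "(\<lambda>x. a * t x) \<in> trig_polys n"
proof -
  obtain c where "t = (\<lambda>x. \<Sum>k\<in>{- int n..int n}. c k * exp (\<i> * of_int k * of_real x))"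
    using assms by (auto simp: trig_polys_def)
  then show ?thesis
    unfolding trig_polys_def
    by (intro CollectI exI[of _ "\<lambda>k. a * c k"]) (simp add: sum_distrib_left mult.assoc)
qed

lemma add_in_trig_polys:
  assumes "s \<in> trig_polys n" "t \<in> trig_polys n"
  shows "(\<lambda>x. s x + t x) \<in> trig_polys n"
proof -
  obtain c d where "s = (\<lambda>x. \<Sum>k\<in>{- int n..int n}. c k * exp (\<i> * of_int k * of_real x))"
    and "t = (\<lambda>x. \<Sum>k\<in>{- int n..int n}. d k * exp (\<i> * of_int k * of_real x))"
    using assms by (auto simp: trig_polys_def)
  then show ?thesis
    unfolding trig_polys_def
    by (intro CollectI exI[of _ "\<lambda>k. c k + d k"]) (simp add: sum.distrib distrib_right)
qed

lemma sum_in_trig_polys: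
  assumes "finite I" "\<And>i. i \<in> I \<Longrightarrow> t i \<in> trig_polys n"
  shows "(\<lambda>x. \<Sum>i\<in>I. t i x) \<in> trig_polys n"
  using assms
proof (induction I rule: finite_induct)
  case empty
  have "(\<lambda>x. 0 * exp (\<i> * of_int 0 * of_real x)) \<in> trig_polys n"
    by (intro cmult_in_trig_polys exp_in_trig_polys) simp
  then show ?case by simp
next
  case (insert i I)
  then show ?case by (simp add: add_in_trig_polys)
qed

lemma mult_in_trig_polys:
  assumes "s \<in> trig_polys a" "t \<in> trig_polys b"
  shows "(\<lambda>x. s x * t x) \<in> trig_polys (a + b)"
proof -
  obtain c d where st: "s = (\<lambda>x. \<Sum>k\<in>{- int a..int a}. c k * exp (\<i> * of_int k * of_real x))"
      "t = (\<lambda>x. \<Sum>k\<in>{- int b..int b}. d k * exp (\<i> * of_int k * of_real x))"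
    using assms by (auto simp: trig_polys_def)
  have "(\<lambda>x. s x * t x) = (\<lambda>x. \<Sum>k\<in>{- int a..int a}. \<Sum>j\<in>{- int b..int b}.
      (c k * d j) * exp (\<i> * of_int (k + j) * of_real x))"
    by (simp add: st sum_product exp_add[symmetric] mult_ac algebra_simps)
  also have "\<dots> \<in> trig_polys (a + b)"
    by (intro sum_in_trig_polys cmult_in_trig_polys exp_in_trig_polys) auto
  finally show ?thesis .
qed

lemma power_in_trig_polys:
  assumes "t \<in> trig_polys a"
  shows "(\<lambda>x. t x ^ p) \<in> trig_polys (p * a)"
proof (induction p)
  case 0
  show ?case using exp_in_trig_polys[of 0 0] by simp
next
  case (Suc p)
  show ?case using mult_in_trig_polys[OF assms Suc] by simp
qed

text \<open>The constant 1 is the exponential of frequency 0 and counts as a polynomial of degree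
  \<open>b - a\<close>; multiplying by it raises the admissible degree.\<close>

lemma trig_polys_mono:
  assumes "a \<le> b"
  shows "trig_polys a \<subseteq> trig_polys b"
proof
  fix t assume "t \<in> trig_polys a"
  then have "(\<lambda>x. t x * exp (\<i> * of_int 0 * of_real x)) \<in> trig_polys (a + (b - a))"
    by (intro mult_in_trig_polys exp_in_trig_polys) auto
  then show "t \<in> trig_polys b" using assms by simp
qed

section \<open>Elementary bounds for sine and cosine\<close>

lemma sin_ge_chord:
  assumes "0 \<le> x" "x \<le> pi / 2"
  shows "2 / pi * x \<le> sin x"
proof -
  \<comment> \<open>Jordan's inequality follows from concavity: sine lies above its chord from 0 to
    \<open>pi / 2\<close>.\<close>
  have "convex_on {0..pi} (\<lambda>x. - sin x)"
    by (rule f''_ge0_imp_convex[where f' = "\<lambda>x. - cos x" and f'' = sin])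
       (auto intro!: derivative_eq_intros sin_ge_zero)
  then have "- sin ((1 - 2 / pi * x) *\<^sub>R 0 + (2 / pi * x) *\<^sub>R (pi / 2))
      \<le> (1 - 2 / pi * x) * (- sin 0) + (2 / pi * x) * (- sin (pi / 2))"
    using assms by (intro convex_onD) (auto simp: field_simps)
  then show ?thesis by simp
qed

text \<open>The modulus equals \<open>2 * \<bar>sin (x / 2)\<bar>\<close>, and the chord bound
  applies at \<open>\<bar>x / 2\<bar>\<close>. This controls the denominator of a geometric sum of
  exponentials.\<close>

lemma norm_exp_i_minus_1_ge:
  assumes "\<bar>x\<bar> \<le> pi"
  shows "2 / pi * \<bar>x\<bar> \<le> cmod (exp (\<i> * of_real x) - 1)"
proof -
  have "2 / pi * \<bar>x / 2\<bar> \<le> sin \<bar>x / 2\<bar>"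
    using assms by (intro sin_ge_chord) auto
  also have "\<dots> \<le> \<bar>sin (x / 2)\<bar>"
    by (simp add: abs_if)
  finally show ?thesis
    by (simp add: dist_exp_i_1)
qed

lemma cos_ge_half:
  fixes x :: real
  assumes "\<bar>x\<bar> \<le> 1"
  shows "1 / 2 \<le> cos x"
proof -
  have "cos (pi / 3) \<le> cos \<bar>x\<bar>"
    using assms pi_gt3 by (intro cos_monotone_0_pi_le) auto
  then show ?thesis by (simp add: cos_60)
qed

text \<open>The test function is the \<open>p\<close>-th power of an average of exponentials of
  frequencies \<open>0..k\<close>. Summing the geometric series gives decay of order 1 for the
  average, hence order \<open>p\<close> for the power, while the choice \<open>k = n div p\<close>
  keeps the degree at most \<open>n\<close>.\<close>

lemma trig_polys_concentrated:
  assumes p: "p \<ge> 1"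
  shows "\<exists>c C. 0 < c \<and> 0 < C \<and> (\<forall>n\<ge>1. \<exists>t\<in>trig_polys n.
    (\<forall>x. cmod (t x) \<le> 1) \<and> (\<forall>x. real n * \<bar>x\<bar> \<le> 1 \<longrightarrow> c \<le> cmod (t x)) \<and>
    (\<forall>x\<in>{- pi..pi}. cmod (t x) * (real n * \<bar>x\<bar>) ^ p \<le> C ^ p))"
proof (rule exI[of _ "(1 / 2) ^ p"], rule exI[of _ "real p * pi"], intro conjI allI impI)
  fix n :: nat assume n: "n \<ge> 1"
  define k where "k = n div p"
  define D where "D x = 1 / of_nat (k + 1) * (\<Sum>j\<le>k. exp (\<i> * of_int (int j) * of_real x))"
    for x :: real
  have D_norm: "cmod (D x) \<le> 1" for x
  proof -
    have "cmod (\<Sum>j\<le>k. exp (\<i> * of_int (int j) * of_real x)) \<le> real (card {..k}) * 1"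
      by (rule sum_norm_bound) (simp add: norm_exp_eq_Re)
    then show ?thesis
      unfolding D_def norm_mult by (simp add: norm_divide divide_le_eq del: of_nat_Suc)
  qed
  have "p * k \<le> n" by (simp add: k_def)
  have "D \<in> trig_polys k"
    unfolding D_def by (intro cmult_in_trig_polys sum_in_trig_polys exp_in_trig_polys) auto
  then have "(\<lambda>x. D x ^ p) \<in> trig_polys n"
    using power_in_trig_polys trig_polys_mono[OF \<open>p * k \<le> n\<close>] by blast
  moreover have "cmod (D x ^ p) \<le> 1" for x
    using D_norm by (simp add: norm_power power_le_one)
  moreover have "(1 / 2) ^ p \<le> cmod (D x ^ p)" if x: "real n * \<bar>x\<bar> \<le> 1" for x
  proof -
    \<comment> \<open>Near 0 no cancellation occurs: all phases \<open>j * x\<close> stay in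
      \<open>[-1, 1]\<close>, so every term has real part at least 1/2.\<close>
    have "1 / 2 \<le> cos (real j * x)" if "j \<le> k" for j
    proof (rule cos_ge_half)
      have "j \<le> n"
        using that div_le_dividend[of n p] unfolding k_def by linarith
      then have "real j * \<bar>x\<bar> \<le> real n * \<bar>x\<bar>"
        by (intro mult_right_mono) auto
      then show "\<bar>real j * x\<bar> \<le> 1"
        using x by (simp add: abs_mult)
    qed
    then have "real (k + 1) * (1 / 2) \<le> (\<Sum>j\<le>k. cos (real j * x))"
      using sum_bounded_below[of "{..k}" "1 / 2" "\<lambda>j. cos (real j * x)"] by simp
    also have "\<dots> = Re (\<Sum>j\<le>k. exp (\<i> * of_int (int j) * of_real x))"
      by (simp add: Re_exp)
    also have "\<dots> \<le> cmod (\<Sum>j\<le>k. exp (\<i> * of_int (int j) * of_real x))"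
      by (rule complex_Re_le_cmod)
    finally have "1 / 2 \<le> cmod (D x)"
      unfolding D_def norm_mult by (simp add: norm_divide field_simps del: of_nat_Suc)
    then show ?thesis
      using power_mono[of "1 / 2" "cmod (D x)" p] by (simp add: norm_power)
  qed
  moreover have "cmod (D x ^ p) * (real n * \<bar>x\<bar>) ^ p \<le> (real p * pi) ^ p"
    if x: "x \<in> {- pi..pi}" for x
  proof -
    let ?S = "\<Sum>j\<le>k. exp (\<i> * of_int (int j) * of_real x)"
    let ?z = "exp (\<i> * of_real x)"
    have "?S = (\<Sum>j\<le>k. ?z ^ j)"
      by (intro sum.cong) (auto simp: exp_of_nat_mult[symmetric] mult_ac)
    then have "(?z - 1) * ?S = ?z ^ Suc k - 1"
      using power_diff_1_eq[of ?z "Suc k"] by (simp add: lessThan_Suc_atMost)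
    then have "cmod (?z - 1) * cmod ?S = cmod (?z ^ Suc k - 1)"
      by (metis norm_mult)
    also have "\<dots> \<le> cmod (?z ^ Suc k) + cmod 1"
      by (rule norm_triangle_ineq4)
    also have "\<dots> = 2"
      by (simp add: norm_mult norm_power norm_exp_eq_Re)
    finally have "cmod (?z - 1) * cmod ?S \<le> 2" .
    moreover have "2 / pi * \<bar>x\<bar> * cmod ?S \<le> cmod (?z - 1) * cmod ?S"
      using x by (intro mult_right_mono norm_exp_i_minus_1_ge) auto
    ultimately have "2 / pi * (\<bar>x\<bar> * cmod ?S) \<le> 2 / pi * pi"
      by (simp add: mult.assoc)
    then have S: "\<bar>x\<bar> * cmod ?S \<le> pi"
      by (rule mult_left_le_imp_le) simp
    \<comment> \<open>Rounding in \<open>n div p\<close> is absorbed by the number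
      \<open>k + 1\<close> of terms, also when \<open>n < p\<close> and
      \<open>k = 0\<close>.\<close>
    have "n \<le> p * (k + 1)"
      using p unfolding k_def
      by (metis Suc_eq_plus1 dividend_less_times_div less_imp_le mult_Suc_right add.commute less_le_trans zero_less_one)
    then have "real n * \<bar>x\<bar> \<le> real (p * (k + 1)) * \<bar>x\<bar>"
      by (intro mult_right_mono) (simp_all only: of_nat_le_iff abs_ge_zero)
    then have "cmod (D x) * (real n * \<bar>x\<bar>) \<le> cmod (D x) * (real (p * (k + 1)) * \<bar>x\<bar>)"
      by (rule mult_left_mono) simp
    also have "\<dots> = cmod ?S / real (k + 1) * (real p * real (k + 1) * \<bar>x\<bar>)"
      unfolding D_def norm_mult of_nat_mult by (simp add: norm_divide del: of_nat_Suc of_nat_add)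
    also have "\<dots> = real p * (\<bar>x\<bar> * cmod ?S)"
      by (simp del: of_nat_Suc)
    also have "\<dots> \<le> real p * pi"
      using S by (rule mult_left_mono) simp
    finally have "(cmod (D x) * (real n * \<bar>x\<bar>)) ^ p \<le> (real p * pi) ^ p"
      by (intro power_mono) auto
    then show ?thesis
      by (simp add: norm_power power_mult_distrib)
  qed
  ultimately show "\<exists>t\<in>trig_polys n. (\<forall>x. cmod (t x) \<le> 1) \<and>
      (\<forall>x. real n * \<bar>x\<bar> \<le> 1 \<longrightarrow> (1 / 2) ^ p \<le> cmod (t x)) \<and>
      (\<forall>x\<in>{- pi..pi}. cmod (t x) * (real n * \<bar>x\<bar>) ^ p \<le> (real p * pi) ^ p)"
    by (intro bexI[of _ "\<lambda>x. D x ^ p"]) auto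
qed (use p in auto)

subsection \<open>Concentrated functions of exponential type\<close>

text \<open>Differentiation costs only one factor \<open>u\<close>: the power \<open>u ^ p\<close>
  survives, and the explicit cofactor is the next \<open>r\<close> in the induction on
  decay.\<close>

lemma pderiv_power_Suc_mult:
  fixes u r :: "'a::idom poly"
  shows "pderiv (u ^ Suc p * r) = u ^ p * (smult (of_nat (Suc p)) (pderiv u) * r + u * pderiv r)"
proof -
  have "pderiv (u ^ Suc p * r)
      = u ^ Suc p * pderiv r + r * (smult (of_nat (Suc p)) (u ^ p) * pderiv u)"
    by (rule trans[OF pderiv_mult]) (rule arg_cong[OF pderiv_power_Suc])
  also have "u ^ Suc p * d + r * (smult c (u ^ p) * d') = u ^ p * (smult c d' * r + u * d)"
    for c d d'
    by (simp add: distrib_left mult.assoc mult.left_commute[of r] mult.commute[of r d'])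
  finally show ?thesis .
qed

text \<open>Repeated integration by parts: the factor \<open>1 - s\<^sup>2\<close> vanishes at both
  endpoints, so each step trades one power of it for one factor \<open>\<bar>x\<bar>\<close>. The
  polynomial \<open>r\<close> is arbitrary to absorb the cofactors that differentiation
  creates.\<close>

lemma fourier_integral_decay:
  fixes r :: "real poly"
  shows "\<exists>B. \<forall>x::real. \<bar>x\<bar> ^ p * cmod (integral {-1..1} (\<lambda>s.
    exp (\<i> * of_real x * of_real s) * of_real (poly ([:1, 0, -1:] ^ p * r) s))) \<le> B"
proof (induction p arbitrary: r)
  case 0
  have "cmod (integral {-1..1} (\<lambda>s. exp (\<i> * of_real x * of_real s) * of_real (poly r s)))
      \<le> integral {-1..1} (\<lambda>s. \<bar>poly r s\<bar>)" for x :: real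
    by (intro integral_norm_bound_integral integrable_continuous_interval continuous_intros)
       (simp add: norm_mult norm_exp_eq_Re)
  then show ?case by auto
next
  case (Suc p)
  define r' where "r' = smult (real (Suc p)) (pderiv [:1, 0, -1:]) * r + [:1, 0, -1:] * pderiv r"
  define q where "q = [:1, 0, -1:] ^ Suc p * r"
  define F where "F f x = integral {-1..1} (\<lambda>s. exp (\<i> * of_real x * of_real s) * of_real (poly f s))"
    for f :: "real poly" and x :: real
  obtain B where B: "\<And>x. \<bar>x\<bar> ^ p * cmod (F ([:1, 0, -1:] ^ p * r') x) \<le> B"
    using Suc[of r'] unfolding F_def by blast
  have q': "pderiv q = [:1, 0, -1:] ^ p * r'"
    unfolding q_def r'_def by (rule pderiv_power_Suc_mult)
  have "\<bar>x\<bar> * cmod (F q x) = cmod (F (pderiv q) x)" for x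
  proof -
    define E where "E s = exp (\<i> * of_real x * of_real s)" for s :: real
    have E: "(E has_vector_derivative (\<i> * of_real x * E s)) (at s within X)" for s X
      unfolding E_def
      by (rule has_vector_derivative_real_field) (auto intro!: derivative_eq_intros)
    have Q: "((\<lambda>s. complex_of_real (poly q s)) has_vector_derivative of_real (poly (pderiv q) s))
        (at s within X)" for s X
      by (rule has_vector_derivative_of_real, rule has_field_derivative_at_within, rule poly_DERIV)
    have "((\<lambda>s. E s * of_real (poly (pderiv q) s) + \<i> * of_real x * E s * of_real (poly q s))
        has_integral (E 1 * of_real (poly q 1) - E (-1) * of_real (poly q (-1)))) {-1..1}"
      by (intro fundamental_theorem_of_calculus has_vector_derivative_mult E Q) simp
    \<comment> \<open>The exponent \<open>Suc p\<close> is positive, so the boundary terms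
      vanish.\<close>
    moreover have "poly q 1 = 0" "poly q (-1) = 0"
      by (simp_all add: q_def)
    ultimately have "((\<lambda>s. E s * of_real (poly (pderiv q) s) + (\<i> * of_real x) * (E s * of_real (poly q s)))
        has_integral 0) {-1..1}"
      by (simp add: mult.assoc)
    moreover have "((\<lambda>s. E s * of_real (poly f s)) has_integral F f x) {-1..1}" for f
      unfolding F_def E_def
      by (intro integrable_integral integrable_continuous_interval continuous_intros)
    then have "((\<lambda>s. E s * of_real (poly (pderiv q) s) + (\<i> * of_real x) * (E s * of_real (poly q s)))
        has_integral (F (pderiv q) x + (\<i> * of_real x) * F q x)) {-1..1}"
      by (intro has_integral_add has_integral_mult_right)
    ultimately have "F (pderiv q) x + (\<i> * of_real x) * F q x = 0"
      using has_integral_unique by blast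
    then have "cmod (F (pderiv q) x) = cmod ((\<i> * of_real x) * F q x)"
      by (metis add_eq_0_iff norm_minus_cancel)
    then show ?thesis
      by (simp add: norm_mult)
  qed
  then have "\<bar>x\<bar> ^ Suc p * cmod (F q x) \<le> B" for x
    using B[of x] q' by (metis power_Suc2 mult.assoc)
  then show ?case
    unfolding F_def q_def by blast
qed

text \<open>The substitution \<open>\<xi> = n * s\<close> stretches the spectrum from
  \<open>[-1, 1]\<close> to \<open>[-n, n]\<close>.\<close>

lemma exp_type_functions_dilate:
  fixes g :: "real \<Rightarrow> complex"
  assumes n: "0 < n" and g: "continuous_on UNIV g"
  shows "(\<lambda>x. integral {-1..1} (\<lambda>s. exp (\<i> * of_real (real n * x) * of_real s) * g s))
    \<in> exp_type_functions n"
proof -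
  define G where "G \<xi> = g (\<xi> / n) / n" for \<xi> :: real
  \<comment> \<open>The density must be square integrable on the whole line, so it is cut off
    outside \<open>[-n, n]\<close>; the integral over that interval does not see the cut.\<close>
  define h where "h \<xi> = indicator {- real n..real n} \<xi> *\<^sub>R G \<xi>" for \<xi> :: real
  have G: "continuous_on X G" for X
    unfolding G_def using n
    by (intro continuous_intros continuous_on_compose2[OF g]) auto
  have int: "set_integrable lebesgue {- real n..real n} f"
    if "continuous_on {- real n..real n} f" for f :: "real \<Rightarrow> 'b::euclidean_space"
    using absolutely_integrable_continuous[of "- real n" "real n" f] that by simp
  have "h \<in> borel_measurable lebesgue"
    using int[OF G] unfolding h_def[abs_def] set_integrable_def by (rule borel_measurable_integrable)
  moreover have "(\<lambda>\<xi>. (cmod (h \<xi>))\<^sup>2)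
      = (\<lambda>\<xi>. indicator {- real n..real n} \<xi> *\<^sub>R (cmod (G \<xi>))\<^sup>2)"
    by (auto simp: h_def indicator_def)
  then have "integrable lebesgue (\<lambda>\<xi>. (cmod (h \<xi>))\<^sup>2)"
    using int[of "\<lambda>\<xi>. (cmod (G \<xi>))\<^sup>2"] G
    by (simp add: set_integrable_def continuous_intros)
  moreover have "integral {-1..1} (\<lambda>s. exp (\<i> * of_real (real n * x) * of_real s) * g s)
      = (LINT \<xi>:{- real n..real n}|lebesgue. exp (\<i> * of_real x * of_real \<xi>) * h \<xi>)" for x
  proof -
    let ?f = "\<lambda>s. exp (\<i> * of_real (real n * x) * of_real s) * g s"
    have "(LINT \<xi>:{- real n..real n}|lebesgue. exp (\<i> * of_real x * of_real \<xi>) * h \<xi>)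
        = (LINT \<xi>:{- real n..real n}|lebesgue. exp (\<i> * of_real x * of_real \<xi>) * G \<xi>)"
      by (intro set_lebesgue_integral_cong) (auto simp: h_def)
    also have "\<dots> = integral {- real n..real n} (\<lambda>\<xi>. exp (\<i> * of_real x * of_real \<xi>) * G \<xi>)"
      by (intro set_lebesgue_integral_eq_integral int continuous_intros G)
    also have "\<dots> = integral ((\<lambda>x. x / (1 / real n)) ` {-1..1}) (\<lambda>\<xi>. ?f (1 / real n * \<xi>) / n)"
    proof -
      have "(\<lambda>x. x / (1 / real n)) ` {-1..1} = {- real n..real n}"
        using n image_mult_atLeastAtMost[of "real n" "-1" 1] by (simp add: mult.commute)
      then show ?thesis
        using n by (simp add: G_def mult.assoc)
    qed
    also have "\<dots> = integral {-1..1} ?f"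
      using n by (subst integral_stretch_real[where f="\<lambda>s. ?f s / n"]) (auto simp: scaleR_conv_of_real)
    finally show ?thesis by simp
  qed
  ultimately show ?thesis
    unfolding exp_type_functions_def by blast
qed

text \<open>The Fourier transform of the bump \<open>(1 - s\<^sup>2)\<^sup>p\<close> on \<open>[-1, 1]\<close> takes the place of a power of the
  Fejer kernel: its spectrum is visibly bounded, so no convolution is needed.\<close>

lemma exp_type_functions_concentrated:
  assumes p: "p \<ge> 1"
  shows "\<exists>c C. 0 < c \<and> 0 < C \<and> (\<forall>n\<ge>1. \<exists>t\<in>exp_type_functions n.
    (\<forall>x. cmod (t x) \<le> 1) \<and> (\<forall>x. real n * \<bar>x\<bar> \<le> 1 \<longrightarrow> c \<le> cmod (t x)) \<and>
    (\<forall>x\<in>UNIV. cmod (t x) * (real n * \<bar>x\<bar>) ^ p \<le> C ^ p))"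
proof -
  define w where "w s = (1 - s\<^sup>2) ^ p" for s :: real
  define I where "I = integral {-1..1} w"
  have w: "0 \<le> w s" if "s \<in> {-1..1}" for s
    using that by (simp add: w_def abs_square_le_1 abs_le_iff)
  have w_cont: "continuous_on X w" for X
    unfolding w_def by (intro continuous_intros)
  have w_int: "w integrable_on {-1..1}"
    using w_cont by (rule integrable_continuous_interval)
  have "0 < I"
  proof -
    \<comment> \<open>A nonnegative continuous function with integral 0 vanishes identically, but
      \<open>w 0 = 1\<close>.\<close>
    have "I \<noteq> 0"
    proof
      assume "I = 0"
      then have "w 0 = 0"
        using integral_eq_0_iff[of "-1" 1 w] w w_cont unfolding I_def by auto
      then show False by (simp add: w_def)
    qed
    moreover have "0 \<le> I"
      unfolding I_def using w w_int by (intro integral_nonneg) auto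
    ultimately show ?thesis by simp
  qed
  \<comment> \<open>Dividing by \<open>I\<close> gives the weight total mass 1, so the transform is
    bounded by 1.\<close>
  define g where "g s = complex_of_real (w s / I)" for s
  define G where "G x = integral {-1..1} (\<lambda>s. exp (\<i> * of_real x * of_real s) * g s)" for x :: real
  have g_cont: "continuous_on X g" for X
    unfolding g_def using \<open>0 < I\<close> by (intro continuous_intros w_cont) auto
  have G_int: "(\<lambda>s. exp (\<i> * of_real x * of_real s) * g s) integrable_on {-1..1}" for x :: real
    by (intro integrable_continuous_interval continuous_intros g_cont)
  have wI: "integral {-1..1} (\<lambda>s. w s / I) = 1"
    using \<open>0 < I\<close> by (simp add: I_def)
  have wI_int: "(\<lambda>s. w s / I) integrable_on {-1..1}"
    using \<open>0 < I\<close> by (intro integrable_continuous_interval continuous_intros w_cont) auto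
  have le1: "cmod (G x) \<le> 1" for x
  proof -
    have "cmod (G x) \<le> integral {-1..1} (\<lambda>s. w s / I)"
      unfolding G_def using w \<open>0 < I\<close>
      by (intro integral_norm_bound_integral G_int wI_int)
         (auto simp: norm_mult norm_exp_eq_Re g_def norm_divide)
    then show ?thesis by (simp only: wI)
  qed
  \<comment> \<open>For \<open>\<bar>x\<bar> \<le> 1\<close> the phase \<open>x * s\<close> stays in
    \<open>[-1, 1]\<close>, so the real part of the integrand is at least half the weight.\<close>
  have ge: "1 / 2 \<le> cmod (G x)" if x: "\<bar>x\<bar> \<le> 1" for x
  proof -
    have "1 / 2 = integral {-1..1} (\<lambda>s. 1 / 2 * (w s / I))"
      by (simp only: integral_mult_right wI)
    also have "\<dots> \<le> integral {-1..1} (\<lambda>s. Re (exp (\<i> * of_real x * of_real s) * g s))"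
    proof (rule integral_le)
      fix s :: real assume s: "s \<in> {-1..1}"
      have "\<bar>x * s\<bar> \<le> 1"
        using x s by (simp add: abs_mult abs_le_iff mult_le_one)
      then have "1 / 2 * (w s / I) \<le> cos (x * s) * (w s / I)"
        using w[OF s] \<open>0 < I\<close> by (intro mult_right_mono cos_ge_half) auto
      also have "\<dots> = Re (exp (\<i> * of_real x * of_real s) * g s)"
        by (simp add: g_def Re_exp Im_exp del: of_real_divide)
      finally show "1 / 2 * (w s / I) \<le> Re (exp (\<i> * of_real x * of_real s) * g s)" .
    qed (use integrable_linear[OF G_int bounded_linear_Re] integrable_on_cmult_left[OF wI_int, of "1 / 2"]
         in \<open>auto simp: o_def\<close>)
    also have "\<dots> = Re (G x)"
      unfolding G_def using integral_linear[OF G_int bounded_linear_Re] by (simp add: o_def)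
    also have "\<dots> \<le> cmod (G x)"
      by (rule complex_Re_le_cmod)
    finally show ?thesis .
  qed
  have "poly ([:1, 0, -1:] ^ p * [:1 / I:]) s = w s / I" for s
    by (simp add: w_def poly_power power2_eq_square)
  then have "\<exists>B. \<forall>x. \<bar>x\<bar> ^ p * cmod (G x) \<le> B"
    using fourier_integral_decay[of p "[:1 / I:]"] unfolding G_def g_def by (simp only:)
  then obtain B where B: "\<And>x. \<bar>x\<bar> ^ p * cmod (G x) \<le> B"
    by blast
  \<comment> \<open>Taking \<open>C\<close> at least 1 gives \<open>B \<le> C \<le> C ^ p\<close>,
    the form of the bound required.\<close>
  define C where "C = max 1 B"
  have "B \<le> C" "1 \<le> C"
    by (auto simp: C_def)
  then have "C \<le> C ^ p"
    using p by (intro self_le_power) auto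
  have decay: "cmod (G x) * \<bar>x\<bar> ^ p \<le> C ^ p" for x
    using B[of x] \<open>B \<le> C\<close> \<open>C \<le> C ^ p\<close> by (simp add: mult.commute)
  show ?thesis
  proof (rule exI[of _ "1 / 2"], rule exI[of _ C], intro conjI allI impI)
    fix n :: nat assume n: "n \<ge> 1"
    then have "(\<lambda>x. G (real n * x)) \<in> exp_type_functions n"
      unfolding G_def by (intro exp_type_functions_dilate g_cont) simp
    then show "\<exists>t\<in>exp_type_functions n. (\<forall>x. cmod (t x) \<le> 1) \<and>
        (\<forall>x. real n * \<bar>x\<bar> \<le> 1 \<longrightarrow> 1 / 2 \<le> cmod (t x)) \<and>
        (\<forall>x\<in>UNIV. cmod (t x) * (real n * \<bar>x\<bar>) ^ p \<le> C ^ p)"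
    proof (rule bexI[rotated], intro conjI allI ballI impI)
      show "cmod (G (real n * x)) \<le> 1" for x
        by (rule le1)
      show "1 / 2 \<le> cmod (G (real n * x))" if "real n * \<bar>x\<bar> \<le> 1" for x
        using that by (intro ge) (simp add: abs_mult)
      show "cmod (G (real n * x)) * (real n * \<bar>x\<bar>) ^ p \<le> C ^ p" for x
        using decay[of "real n * x"] by (simp add: abs_mult)
    qed
  qed (auto simp: C_def)
qed

subsection \<open>Lower bound for the Nikol'skii functional\<close>

lemma inverse_ennreal_antimono:
  fixes a b :: ennreal
  assumes "a \<le> b"
  shows "inverse b \<le> inverse a"
proof (cases "a = 0 \<or> b = top")
  case False
  with assms obtain r s where "a = ennreal r" "b = ennreal s" "0 < r" "r \<le> s"
    by (cases a; cases b) (auto simp: top_unique)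
  then show ?thesis
    by (simp add: inverse_ennreal ennreal_leI le_imp_inverse_le)
qed auto

lemma nn_integral_lborel_scale:
  assumes [measurable]: "h \<in> borel_measurable borel" and "a \<noteq> 0"
  shows "(\<integral>\<^sup>+x. h (a * x) \<partial>lborel) = ennreal (1 / \<bar>a\<bar>) * (\<integral>\<^sup>+x. h x \<partial>lborel)"
proof -
  have "(\<integral>\<^sup>+x. h x \<partial>lborel) = ennreal \<bar>a\<bar> * (\<integral>\<^sup>+x. h (a * x) \<partial>lborel)"
    using nn_integral_real_affine[of h a 0] assms by simp
  then have "ennreal (1 / \<bar>a\<bar>) * (\<integral>\<^sup>+x. h x \<partial>lborel)
      = ennreal (1 / \<bar>a\<bar> * \<bar>a\<bar>) * (\<integral>\<^sup>+x. h (a * x) \<partial>lborel)"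
    by (simp add: ennreal_mult' mult.assoc del: ennreal_1 times_divide_eq_left)
  then show ?thesis using assms(2) by simp
qed

text \<open>The integral is split at \<open>\<bar>x\<bar> = C / r\<close>. The core has length
  \<open>2 * C / r\<close> and integrand at most \<open>\<Phi> v\<close>; each of the two tails is a
  dilate of the integral in \<open>tail\<close>. Bounding \<open>\<Phi> v\<close> and
  \<open>\<Phi> (D * v)\<close> by one value gives the constant 4.\<close>

lemma nn_integral_orlicz_le:
  fixes t :: "real \<Rightarrow> complex"
  assumes \<Phi>: "orlicz_function \<Phi>"
    and tail: "(\<integral>\<^sup>+y\<in>{1..}. ennreal (\<Phi> (v / y ^ p)) \<partial>lebesgue) \<le> ennreal (\<Phi> (D * v))"
    and pos: "0 < C" "0 < r" "0 < v" "0 < D"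
    and T: "T \<in> sets lebesgue"
    and t: "\<And>x. cmod (t x) \<le> 1" "\<And>x. x \<in> T \<Longrightarrow> cmod (t x) * (r * \<bar>x\<bar>) ^ p \<le> C ^ p"
  shows "(\<integral>\<^sup>+x. ennreal (\<Phi> (v * cmod (t x))) \<partial>lebesgue_on T)
    \<le> ennreal (4 * C / r * \<Phi> (max 1 D * v))"
proof -
  note nn = orlicz_function_nonneg[OF \<Phi>]
  note [measurable] = orlicz_function_measurable[OF \<Phi>]
  \<comment> \<open>With this scale the decay reads
    \<open>cmod (t x) \<le> 1 / (a * \<bar>x\<bar>) ^ p\<close>, and the split point becomes
    \<open>a * \<bar>x\<bar> = 1\<close>.\<close>
  define a where "a = r / C"
  have a: "0 < a" using pos by (simp add: a_def)
  \<comment> \<open>Since \<open>h\<close> vanishes below 1, \<open>h (a * x)\<close> and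
    \<open>h (- a * x)\<close> live on opposite half-lines, and their sum covers both tails.\<close>
  define h where "h y = ennreal (\<Phi> (v / y ^ p)) * indicator {1..} y" for y
  have [measurable]: "h \<in> borel_measurable borel"
    unfolding h_def by measurable
  have ptw: "ennreal (\<Phi> (v * cmod (t x)))
      \<le> ennreal (\<Phi> v) * indicator {-(1/a)..1/a} x + (h (a * x) + h (- a * x))" if "x \<in> T" for x
  proof (cases "\<bar>x\<bar> \<le> 1 / a")
    case True
    then have "x \<in> {-(1/a)..1/a}" by auto
    moreover have "\<Phi> (v * cmod (t x)) \<le> \<Phi> v"
      using pos t(1)[of x] by (intro orlicz_function_mono[OF \<Phi>]) auto
    ultimately show ?thesis
      by (simp add: ennreal_leI add_increasing2)
  next
    case False
    then have y: "1 < a * \<bar>x\<bar>"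
      using a by (simp add: field_simps)
    have "cmod (t x) * (a * \<bar>x\<bar>) ^ p = cmod (t x) * (r * \<bar>x\<bar>) ^ p / C ^ p"
      by (simp add: a_def power_divide)
    also have "\<dots> \<le> 1"
      using t(2)[OF that] pos by simp
    finally have "cmod (t x) \<le> 1 / (a * \<bar>x\<bar>) ^ p"
      using y by (simp add: pos_le_divide_eq)
    then have "\<Phi> (v * cmod (t x)) \<le> \<Phi> (v / (a * \<bar>x\<bar>) ^ p)"
      using pos mult_left_mono[of "cmod (t x)" "1 / (a * \<bar>x\<bar>) ^ p" v]
      by (intro orlicz_function_mono[OF \<Phi>]) auto
    then have "ennreal (\<Phi> (v * cmod (t x))) \<le> h (a * \<bar>x\<bar>)"
      using y by (simp add: h_def ennreal_leI)
    also have "\<dots> \<le> h (a * x) + h (- a * x)"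
      by (cases "0 \<le> x") auto
    also have "\<dots> \<le> ennreal (\<Phi> v) * indicator {-(1/a)..1/a} x + (h (a * x) + h (- a * x))"
      by simp
    finally show ?thesis .
  qed
  have H: "(\<integral>\<^sup>+y. h y \<partial>lborel) \<le> ennreal (\<Phi> (D * v))"
    using tail unfolding h_def by (simp add: nn_integral_completion)
  have "(\<integral>\<^sup>+x. ennreal (\<Phi> (v * cmod (t x))) \<partial>lebesgue_on T)
      = (\<integral>\<^sup>+x. ennreal (\<Phi> (v * cmod (t x))) * indicator T x \<partial>lebesgue)"
    using T by (simp add: nn_integral_restrict_space)
  also have "\<dots> \<le> (\<integral>\<^sup>+x. ennreal (\<Phi> v) * indicator {-(1/a)..1/a} x + (h (a * x) + h (- a * x)) \<partial>lebesgue)"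
    using ptw by (intro nn_integral_mono) (auto simp: indicator_def)
  also have "\<dots> = (\<integral>\<^sup>+x. ennreal (\<Phi> v) * indicator {-(1/a)..1/a} x + (h (a * x) + h (- a * x)) \<partial>lborel)"
    by (rule nn_integral_completion)
  also have "\<dots> = (\<integral>\<^sup>+x. ennreal (\<Phi> v) * indicator {-(1/a)..1/a} x \<partial>lborel)
      + ((\<integral>\<^sup>+x. h (a * x) \<partial>lborel) + (\<integral>\<^sup>+x. h (- a * x) \<partial>lborel))"
    by (simp add: nn_integral_add)
  also have "\<dots> = ennreal (\<Phi> v) * ennreal (2 / a)
      + (ennreal (1 / a) * (\<integral>\<^sup>+y. h y \<partial>lborel) + ennreal (1 / a) * (\<integral>\<^sup>+y. h y \<partial>lborel))"
    using a nn_integral_lborel_scale[of h a] nn_integral_lborel_scale[of h "- a"]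
    by (simp add: nn_integral_cmult_indicator)
  also have "\<dots> \<le> ennreal (\<Phi> v) * ennreal (2 / a)
      + (ennreal (1 / a) * ennreal (\<Phi> (D * v)) + ennreal (1 / a) * ennreal (\<Phi> (D * v)))"
    using H by (intro add_mono mult_left_mono) auto
  also have "\<dots> = ennreal (2 / a * (\<Phi> v + \<Phi> (D * v)))"
  proof -
    have mult: "ennreal (\<Phi> v) * ennreal (2 / a) = ennreal (\<Phi> v * (2 / a))"
      "ennreal (1 / a) * ennreal (\<Phi> (D * v)) = ennreal (1 / a * \<Phi> (D * v))"
      using a nn by (intro ennreal_mult[symmetric]; simp)+
    have "ennreal x + (ennreal y + ennreal y) = ennreal (x + (y + y))" if "0 \<le> x" "0 \<le> y" for x y
      using that by (simp only: ennreal_plus add_nonneg_nonneg)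
    moreover have "\<Phi> v * (2 / a) + (1 / a * \<Phi> (D * v) + 1 / a * \<Phi> (D * v))
        = 2 / a * (\<Phi> v + \<Phi> (D * v))"
      by (simp add: distrib_left add_divide_distrib mult.commute)
    moreover have "0 \<le> \<Phi> v * (2 / a)" "0 \<le> 1 / a * \<Phi> (D * v)"
      using a nn by simp_all
    ultimately show ?thesis
      unfolding mult by presburger
  qed
  also have "\<dots> \<le> ennreal (2 / a * (\<Phi> (max 1 D * v) + \<Phi> (max 1 D * v)))"
  proof -
    have "1 * v \<le> max 1 D * v" "D * v \<le> max 1 D * v"
      using pos by (intro mult_right_mono; simp)+
    then have "\<Phi> v \<le> \<Phi> (max 1 D * v)" "\<Phi> (D * v) \<le> \<Phi> (max 1 D * v)"
      using pos orlicz_function_mono[OF \<Phi>, of v "max 1 D * v"]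
        orlicz_function_mono[OF \<Phi>, of "D * v" "max 1 D * v"] by simp_all
    then have "\<Phi> v + \<Phi> (D * v) \<le> \<Phi> (max 1 D * v) + \<Phi> (max 1 D * v)"
      by (rule add_mono)
    then show ?thesis
      using a by (intro ennreal_leI mult_left_mono) simp_all
  qed
  also have "\<dots> = ennreal (4 * C / r * \<Phi> (max 1 D * v))"
    by (simp add: a_def mult.assoc)
  finally show ?thesis .
qed

text \<open>A single admissible \<open>t\<close> bounds the supremum from below. Positivity and
  finiteness of the two fundamental functions justify the cancellations in
  \<open>ennreal\<close>.\<close>

lemma nikolskii_W_ge:
  assumes A: "t \<in> A n" "t \<noteq> (\<lambda>x. 0)" and fin: "X t < \<infinity>" "0 < Y t" "Y t < \<infinity>"
    and X: "0 < fundamental_function M X (K1 / \<sigma> n)" "fundamental_function M X (K1 / \<sigma> n) < \<infinity>"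
      "ennreal c * fundamental_function M X (K1 / \<sigma> n) \<le> X t"
    and Y: "0 < fundamental_function M Y (K2 / \<sigma> n)" "fundamental_function M Y (K2 / \<sigma> n) < \<infinity>"
      "Y t \<le> ennreal K * fundamental_function M Y (K2 / \<sigma> n)"
    and pos: "0 < c" "0 < K"
  shows "ennreal (c / K) \<le> nikolskii_W M A \<sigma> X Y K1 K2 n"
proof -
  let ?x = "fundamental_function M X (K1 / \<sigma> n)" and ?y = "fundamental_function M Y (K2 / \<sigma> n)"
  have "ennreal c = ennreal c * ?x / ?x"
    using X by (simp add: mult_divide_eq_ennreal)
  also have "\<dots> \<le> X t / ?x"
    using X by (intro divide_right_mono_ennreal) auto
  finally have 1: "ennreal c \<le> X t / ?x" .
  have "Y t / ?y \<le> ennreal K * ?y / ?y"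
    using Y by (intro divide_right_mono_ennreal) auto
  also have "\<dots> = ennreal K"
    using Y by (simp add: mult_divide_eq_ennreal)
  finally have 2: "Y t / ?y \<le> ennreal K" .
  have "ennreal (c / K) = ennreal c / ennreal K"
    using pos by (simp add: divide_ennreal)
  also have "\<dots> \<le> (X t / ?x) / ennreal K"
    using 1 by (rule divide_right_mono_ennreal)
  also have "\<dots> \<le> (X t / ?x) / (Y t / ?y)"
    using 2 unfolding divide_ennreal_def by (intro mult_left_mono inverse_ennreal_antimono) auto
  also have "\<dots> \<le> nikolskii_W M A \<sigma> X Y K1 K2 n"
    unfolding nikolskii_W_def using A fin by (intro SUP_upper) auto
  finally show ?thesis .
qed

text \<open>The witnesses are \<open>K1 = 2\<close>, from the interval \<open>[-1/n, 1/n]\<close>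
  where \<open>\<bar>t\<bar> \<ge> c\<close>; \<open>K2 = 4 * C\<close>, from the modular bound; and
  \<open>K3 = c / K \<Phi>2\<close>, the quotient of the two norm constants.\<close>

lemma nikolskii_W_lower_bound:
  fixes T :: "real set" and A :: "nat \<Rightarrow> (real \<Rightarrow> complex) set"
  assumes \<Phi>: "orlicz_function \<Phi>1" "orlicz_function \<Phi>2"
    and T: "T \<in> sets lebesgue" "{- pi..pi} \<subseteq> T"
    and D: "0 < D" "\<And>\<Phi> v. \<Phi> \<in> {\<Phi>1, \<Phi>2} \<Longrightarrow> 1 \<le> v \<Longrightarrow>
      (\<integral>\<^sup>+y\<in>{1..}. ennreal (\<Phi> (v / y ^ p)) \<partial>lebesgue) \<le> ennreal (\<Phi> (D * v))"
    and A: "\<exists>c C. 0 < c \<and> 0 < C \<and> (\<forall>n\<ge>1. \<exists>t\<in>A n.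
      (\<forall>x. cmod (t x) \<le> 1) \<and> (\<forall>x. real n * \<bar>x\<bar> \<le> 1 \<longrightarrow> c \<le> cmod (t x)) \<and>
      (\<forall>x\<in>T. cmod (t x) * (real n * \<bar>x\<bar>) ^ p \<le> C ^ p))"
  shows "\<exists>(K1::real) (K2::real) (K3::real). 0 < K1 \<and> 0 < K2 \<and> 0 < K3 \<and>
           liminf (nikolskii_W (lebesgue_on T) A real
                     (orlicz_norm (lebesgue_on T) \<Phi>1) (orlicz_norm (lebesgue_on T) \<Phi>2) K1 K2)
             \<ge> ennreal K3"
proof -
  obtain c C where c: "0 < c" and C: "0 < C" and "\<And>n. n \<ge> 1 \<Longrightarrow> \<exists>t\<in>A n.
      (\<forall>x. cmod (t x) \<le> 1) \<and> (\<forall>x. real n * \<bar>x\<bar> \<le> 1 \<longrightarrow> c \<le> cmod (t x)) \<and>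
      (\<forall>x\<in>T. cmod (t x) * (real n * \<bar>x\<bar>) ^ p \<le> C ^ p)"
    using A by blast
  then obtain t where t: "\<And>n. n \<ge> 1 \<Longrightarrow> t n \<in> A n"
      "\<And>n x. n \<ge> 1 \<Longrightarrow> cmod (t n x) \<le> 1"
      "\<And>n x. n \<ge> 1 \<Longrightarrow> real n * \<bar>x\<bar> \<le> 1 \<Longrightarrow> c \<le> cmod (t n x)"
      "\<And>n x. n \<ge> 1 \<Longrightarrow> x \<in> T \<Longrightarrow> cmod (t n x) * (real n * \<bar>x\<bar>) ^ p \<le> C ^ p"
    by metis
  let ?M = "lebesgue_on T"
  define D' where "D' = max 1 D"
  \<comment> \<open>This is the constant of \<open>orlicz_norm_le_gauge\<close> with
    \<open>\<Delta> = 4 * C\<close>, which dominates \<open>4 * C / n\<close> for all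
    \<open>n \<ge> 1\<close>, so it is independent of \<open>n\<close>.\<close>
  define K where "K \<Phi> = D' * (1 + 4 * C * \<Phi> D')" for \<Phi> :: "real \<Rightarrow> real"
  have K: "0 < K \<Phi>" if "orlicz_function \<Phi>" for \<Phi>
    using orlicz_function_nonneg[OF that, of D'] C
    by (auto simp: K_def D'_def intro!: mult_pos_pos add_pos_nonneg)
  have interval: "{0..b} \<in> sets ?M \<and> emeasure ?M {0..b} = ennreal b"
    if "0 \<le> b" "b \<le> pi" for b
  proof -
    have "{0..b} \<subseteq> T"
      using that T by auto
    then show ?thesis
      using that T by (auto simp: sets_restrict_space_iff emeasure_restrict_space)
  qed
  \<comment> \<open>The condition on \<open>4 * C / pi\<close> makes
    \<open>4 * C / n \<le> pi\<close>, so \<open>T\<close> contains an interval of that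
    length.\<close>
  have bound: "ennreal (c / K \<Phi>2) \<le> nikolskii_W ?M A real
      (orlicz_norm ?M \<Phi>1) (orlicz_norm ?M \<Phi>2) 2 (4 * C) n"
    if n: "n \<ge> 1" "4 * C / pi \<le> real n" for n
  proof -
    have n0: "0 < real n" using n by simp
    define S where "S = {- (1 / real n)..1 / real n}"
    have "1 / real n \<le> 1"
      using n by simp
    then have "1 / real n \<le> pi"
      using pi_gt3 by linarith
    then have "S \<subseteq> T"
      using T unfolding S_def by (intro order_trans[OF _ T(2)]) auto
    then have S: "S \<in> sets ?M" "emeasure ?M S = ennreal (2 / real n)"
      using T by (auto simp: S_def sets_restrict_space_iff emeasure_restrict_space)
    have S_ge: "c \<le> cmod (t n x)" if "x \<in> S" for x
    proof (rule t(3)[OF n(1)])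
      show "real n * \<bar>x\<bar> \<le> 1"
        using that n0 by (auto simp: S_def field_simps abs_le_iff)
    qed
    have lower: "ennreal c * orlicz_gauge \<Phi> (2 / real n) \<le> orlicz_norm ?M \<Phi> (t n)"
      if "orlicz_function \<Phi>" for \<Phi>
      using S S_ge c by (intro orlicz_norm_ge_gauge[OF that]) auto
    have upper: "orlicz_norm ?M \<Phi> (t n) \<le> ennreal (K \<Phi>) * orlicz_gauge \<Phi> (4 * C / real n)"
      if "\<Phi> \<in> {\<Phi>1, \<Phi>2}" for \<Phi>
      unfolding K_def
    proof (rule orlicz_norm_le_gauge)
      show \<Phi>': "orlicz_function \<Phi>" using that \<Phi> by auto
      show "4 * C / real n \<le> 4 * C"
        using C n by (simp add: field_simps)
      show "(\<integral>\<^sup>+x. ennreal (\<Phi> (v * cmod (t n x))) \<partial>?M) \<le> ennreal (4 * C / real n * \<Phi> (D' * v))"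
        if "1 \<le> v" for v
        unfolding D'_def
        using D that \<open>\<Phi> \<in> {\<Phi>1, \<Phi>2}\<close> C n0 t(2,4)[OF n(1)] T
        by (intro nn_integral_orlicz_le[OF \<Phi>', where p = p]) auto
    qed (use C n in \<open>auto simp: D'_def\<close>)
    \<comment> \<open>Admissibility of \<open>t n\<close> requires finite norms in both spaces, so
      the upper bound is used for \<open>\<Phi>1\<close> as well.\<close>
    have fin: "orlicz_norm ?M \<Phi> (t n) < \<infinity>" if "\<Phi> \<in> {\<Phi>1, \<Phi>2}" for \<Phi>
      using upper[OF that] orlicz_gauge_less_top[of \<Phi> "4 * C / real n"]
      by (auto intro: le_less_trans simp: ennreal_mult_less_top)
    have norm_pos: "0 < orlicz_norm ?M \<Phi>2 (t n)"
      using orlicz_gauge_pos[OF \<Phi>(2), of "2 / real n"] c n0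
      by (intro less_le_trans[OF _ lower[OF \<Phi>(2)]]) (simp add: ennreal_zero_less_mult_iff)
    have "4 * C / real n \<le> pi"
      using n n0 by (simp add: field_simps)
    then have gauge_le: "orlicz_gauge \<Phi>2 (4 * C / real n)
        \<le> fundamental_function ?M (orlicz_norm ?M \<Phi>2) (4 * C / real n)"
      using interval[of "4 * C / real n"] C by (intro fundamental_function_ge_gauge[OF \<Phi>(2)]) auto
    show ?thesis
    proof (rule nikolskii_W_ge[where t = "t n"])
      show "t n \<in> A n"
        using t(1) n by blast
      show "t n \<noteq> (\<lambda>x. 0)"
        using t(3)[OF n(1), of 0] c by auto
      show "0 < fundamental_function ?M (orlicz_norm ?M \<Phi>1) (2 / real n)"
        using S orlicz_gauge_pos[OF \<Phi>(1), of "2 / real n"] n0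
        by (intro less_le_trans[OF _ fundamental_function_ge_gauge[OF \<Phi>(1)]]) auto
      show "fundamental_function ?M (orlicz_norm ?M \<Phi>1) (2 / real n) < \<infinity>"
        using fundamental_function_le_gauge[OF \<Phi>(1)] orlicz_gauge_less_top by (rule le_less_trans) simp
      show "ennreal c * fundamental_function ?M (orlicz_norm ?M \<Phi>1) (2 / real n)
          \<le> orlicz_norm ?M \<Phi>1 (t n)"
        using fundamental_function_le_gauge[OF \<Phi>(1), of "2 / real n" ?M]
        by (intro order_trans[OF _ lower[OF \<Phi>(1)]] mult_left_mono) auto
      show "0 < fundamental_function ?M (orlicz_norm ?M \<Phi>2) (4 * C / real n)"
        using orlicz_gauge_pos[OF \<Phi>(2), of "4 * C / real n"] C n0
        by (intro less_le_trans[OF _ gauge_le]) auto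
      show "fundamental_function ?M (orlicz_norm ?M \<Phi>2) (4 * C / real n) < \<infinity>"
        using fundamental_function_le_gauge[OF \<Phi>(2)] orlicz_gauge_less_top
        by (rule le_less_trans) (use C in simp)
      show "orlicz_norm ?M \<Phi>2 (t n)
          \<le> ennreal (K \<Phi>2) * fundamental_function ?M (orlicz_norm ?M \<Phi>2) (4 * C / real n)"
        using gauge_le by (intro order_trans[OF upper] mult_left_mono) auto
    qed (use fin norm_pos c K[OF \<Phi>(2)] in auto)
  qed
  have "\<forall>\<^sub>F n in sequentially. 4 * C / pi \<le> real n"
    using filterlim_real_sequentially unfolding filterlim_at_top by blast
  with eventually_ge_at_top[of 1] have "\<forall>\<^sub>F n in sequentially. ennreal (c / K \<Phi>2)
      \<le> nikolskii_W ?M A real (orlicz_norm ?M \<Phi>1) (orlicz_norm ?M \<Phi>2) 2 (4 * C) n"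
    by eventually_elim (rule bound)
  then have "ennreal (c / K \<Phi>2) \<le> liminf (nikolskii_W ?M A real
      (orlicz_norm ?M \<Phi>1) (orlicz_norm ?M \<Phi>2) 2 (4 * C))"
    by (rule Liminf_bounded)
  moreover have "0 < 4 * C" "0 < c / K \<Phi>2"
    using c C K[OF \<Phi>(2)] by simp_all
  ultimately show ?thesis
    using zero_less_numeral by blast
qed

theorem theorem3:
  fixes \<Phi>1 \<Phi>2 :: "real \<Rightarrow> real"
    and T :: "real set"
    and A :: "nat \<Rightarrow> (real \<Rightarrow> complex) set"
  assumes "orlicz_function \<Phi>1" and "orlicz_function \<Phi>2"
    and "(T = {- pi..pi} \<and> A = trig_polys) \<or> (T = UNIV \<and> A = exp_type_functions)"
    and "\<exists>(m::nat) (C::real). m \<ge> 1 \<and> C > 0 \<and>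
           (\<forall>\<Phi>\<in>{\<Phi>1, \<Phi>2}. \<forall>v\<ge>1.
              (\<integral>\<^sup>+y\<in>{1..}. ennreal (\<Phi> (v / y ^ (2 * m))) \<partial>lebesgue) \<le> ennreal (\<Phi> (C * v)))"
  shows "\<exists>(K1::real) (K2::real) (K3::real). 0 < K1 \<and> 0 < K2 \<and> 0 < K3 \<and>
           liminf (nikolskii_W (lebesgue_on T) A real
                     (orlicz_norm (lebesgue_on T) \<Phi>1) (orlicz_norm (lebesgue_on T) \<Phi>2) K1 K2)
             \<ge> ennreal K3"
proof -
  obtain m :: nat and C where m: "m \<ge> 1" and C: "C > 0"
    and int: "\<And>\<Phi> v. \<Phi> \<in> {\<Phi>1, \<Phi>2} \<Longrightarrow> 1 \<le> v \<Longrightarrow>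
      (\<integral>\<^sup>+y\<in>{1..}. ennreal (\<Phi> (v / y ^ (2 * m))) \<partial>lebesgue) \<le> ennreal (\<Phi> (C * v))"
    using assms(4) by auto
  \<comment> \<open>The test functions are built with decay order \<open>2 * m\<close>, the exponent
    in the integral condition.\<close>
  have m2: "2 * m \<ge> 1"
    using m by simp
  show ?thesis
    using assms(3)
  proof (elim disjE conjE)
    assume T: "T = {- pi..pi}" "A = trig_polys"
    show ?thesis
      unfolding T
      by (rule nikolskii_W_lower_bound[OF assms(1,2) _ _ C int trig_polys_concentrated[OF m2]]) auto
  next
    assume T: "T = UNIV" "A = exp_type_functions"
    show ?thesis
      unfolding T
      by (rule nikolskii_W_lower_bound[OF assms(1,2) _ _ C int exp_type_functions_concentrated[OF m2]]) auto
  qed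
qed

end
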